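(* Let $P\subset\mathbb{R}^2$ be the convex hull of the set $$Q=\{Q(n;d_1,\dots,d_n)\mid n\ge 1,\ d_i\ge 1 \text{ integers},\ \textstyle\sum_{i=1}^n d_i\ge 5\}$$ of Chern ratios of smooth complete intersection threefolds with ample canonical class. Then $P$ is a rational polyhedron with infinitely many faces, and the corners of $P$ are exactly the following points: $$Q(1;5)=\left(\tfrac1{16},\tfrac{43}{8}\right),\quad Q(2;2,3)=\left(\tfrac1{10},\tfrac{19}{5}\right),\quad Q(3;1,2,2)=\left(\tfrac18,\tfrac{13}{4}\right),\quad Q(3;2,2,2)=\left(\tfrac13,\tfrac{23}{12}\right),$$ and, for every integer $n\ge 5$, $$Q(n;1,\dots,1)=\left(\frac{2(n-4)^2}{n^2-5n+12},\ \frac{n^3-3n^2+14n-24}{3(n-4)(n^2-5n+12)}\right).$$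
   Context: Varieties are over $\mathbb{C}$. For a positive integer $n$ and integers $d_1,\dots,d_n\ge 1$, let $X\subset\mathbb{P}^{n+3}$ be a smooth threefold that is the complete intersection of $n$ hypersurfaces of degrees $d_1+1,\dots,d_n+1$. Write $c_i=c_i(T_X)$; the Chern numbers $c_1^3,c_1c_2,c_3$ are the degrees of the corresponding top-degree classes, and depend only on $(d_1,\dots,d_n)$. The canonical class of $X$ is ample if and only if $\sum d_i\ge 5$, and in that case $c_1c_2<0$. One sets $$Q(n;d_1,\dots,d_n)=\left(\frac{c_1^3}{c_1c_2},\frac{c_3}{c_1c_2}\right)\in\mathbb{R}^2 .$$ Explicitly, with $s_j=\sum_i d_i^j$ and $h$ the hyperplane class, $c_i(T_X)=c_i(n;d_1,\dots,d_n)\,h^i$, where $c_1(n;d_1,\dots,d_n)=4-s_1$, $c_2(n;d_1,\dots,d_n)=\frac{s_1^2+s_2}{2}-3(s_1-2)$, $c_3(n;d_1,\dots,d_n)=-\frac{s_1^3+3s_1s_2+2s_3}{6}+(s_1^2+s_2)-3s_1+4$, so the Chern ratios may be computed with these numbers (the common factor $h^3=\deg X$ cancels). A corner of $P$ means an extreme point of the convex set $P$. "Rational polyhedron with infinitely many faces" is used in the generalized sense: $P$ is the convex hull of its corners, all of its corners have rational coordinates, and there are infinitely many of them (hence infinitely many faces). *)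

theory Defs
  imports "HOL-Analysis.Analysis" "HOL-Computational_Algebra.Formal_Power_Series"
begin

text \<open>
  A list \<open>ds = [d\<^sub>1, \<dots>, d\<^sub>n]\<close> stands for a smooth threefold \<open>X\<close> in projective space of
  dimension \<open>n + 3\<close> over the complex numbers that is a complete intersection of hypersurfaces of
  degrees \<open>d\<^sub>i + 1\<close> (not \<open>d\<^sub>i\<close>); thus \<open>n\<close> is the length of the list. Such threefolds exist for
  all \<open>d\<^sub>i \<ge> 1\<close> by Bertini's theorem, and the Chern numbers depend only on the list.

  The Euler sequence and the normal bundle sequence give
  \<open>c(T\<^sub>X) = (1 + h)\<^sup>n\<^sup>+\<^sup>4 / (\<Prod>i. 1 + (d\<^sub>i + 1) h)\<close>, where \<open>h\<close> is the hyperplane class. Here \<open>h\<close> is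
  the formal variable, and the coefficient of \<open>h\<^sup>i\<close> represents \<open>c\<^sub>i(T\<^sub>X)\<close> for \<open>i \<le> 3\<close> only
  (on the threefold, \<open>h\<^sup>4 = 0\<close>).
\<close>

definition total_chern :: "nat list \<Rightarrow> real fps" where
  "total_chern ds =
     (1 + fps_X) ^ (length ds + 4) * inverse (\<Prod>d\<leftarrow>ds. 1 + fps_const (real (d + 1)) * fps_X)"

definition chern_coeff :: "nat \<Rightarrow> nat list \<Rightarrow> real" where
  "chern_coeff i ds = fps_nth (total_chern ds) i"

text \<open>The degree of \<open>h\<^sup>3\<close> on \<open>X\<close>, by Bezout's theorem.\<close>

definition ci_degree :: "nat list \<Rightarrow> real" where
  "ci_degree ds = (\<Prod>d\<leftarrow>ds. real (d + 1))"

definition chern_number_111 :: "nat list \<Rightarrow> real" where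
  "chern_number_111 ds = chern_coeff 1 ds ^ 3 * ci_degree ds"

definition chern_number_12 :: "nat list \<Rightarrow> real" where
  "chern_number_12 ds = chern_coeff 1 ds * chern_coeff 2 ds * ci_degree ds"

definition chern_number_3 :: "nat list \<Rightarrow> real" where
  "chern_number_3 ds = chern_coeff 3 ds * ci_degree ds"

definition chern_ratios :: "nat list \<Rightarrow> real \<times> real" where
  "chern_ratios ds =
     (chern_number_111 ds / chern_number_12 ds, chern_number_3 ds / chern_number_12 ds)"

text \<open>
  The canonical class of \<open>X\<close> is \<open>(\<Sum>i. d\<^sub>i) - 4\<close> times the hyperplane class, so it is ample iff
  \<open>\<Sum>i. d\<^sub>i \<ge> 5\<close>.
\<close>

definition general_type_ratios :: "(real \<times> real) set" where
  "general_type_ratios =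
     {chern_ratios ds | ds. length ds \<ge> 1 \<and> (\<forall>d \<in> set ds. d \<ge> 1) \<and> sum_list ds \<ge> 5}"

definition corners :: "'a::real_vector set \<Rightarrow> 'a set" where
  "corners P = {x. x extreme_point_of P}"

text \<open>
  Polyhedra in the generalized sense, with possibly infinitely many corners; unlike
  \<^const>\<open>polyhedron\<close>, this does not require a finite intersection of half-spaces, nor closedness.
\<close>

definition gen_rational_polyhedron :: "(real \<times> real) set \<Rightarrow> bool" where
  "gen_rational_polyhedron P \<longleftrightarrow> P = convex hull (corners P) \<and> corners P \<subseteq> \<rat> \<times> \<rat>"

text \<open>Agreement with the explicit formulas in terms of the power sums \<open>s\<^sub>j = (\<Sum>i. d\<^sub>i\<^sup>j)\<close>.\<close>

definition power_sum :: "nat \<Rightarrow> nat list \<Rightarrow> real" where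
  "power_sum j ds = (\<Sum>d\<leftarrow>ds. real d ^ j)"

lemma total_chern_Cons:
  "total_chern (d # ds) * (1 + fps_const (real (d + 1)) * fps_X) = total_chern ds * (1 + fps_X)"
proof -
  define f where "f = 1 + fps_const (real (d + 1)) * fps_X"
  define g where "g = (\<Prod>d\<leftarrow>ds. 1 + fps_const (real (d + 1)) * fps_X)"
  define u where "u = (1 + fps_X :: real fps)"
  have "fps_nth f 0 \<noteq> 0"
    by (simp add: f_def)
  then have "inverse f * f = 1"
    by (rule inverse_mult_eq_1)
  moreover have "total_chern (d # ds) = u * u ^ (length ds + 4) * inverse (f * g)"
    by (simp add: total_chern_def f_def g_def power_add eval_nat_numeral flip: u_def)
  ultimately have "total_chern (d # ds) * f = u * u ^ (length ds + 4) * inverse g"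
    by (simp add: fps_inverse_mult mult_ac)
  also have "\<dots> = total_chern ds * u"
    by (simp only: total_chern_def g_def mult_ac flip: u_def)
  finally show ?thesis
    by (simp add: f_def u_def)
qed

lemma chern_coeff_0: "chern_coeff 0 ds = 1"
proof -
  have "fps_nth (\<Prod>d\<leftarrow>ds. 1 + fps_const (real (d + 1)) * fps_X) 0 = 1"
    by (induction ds) simp_all
  then show ?thesis
    by (simp add: chern_coeff_def total_chern_def fps_power_zeroth)
qed

lemma chern_coeff_Cons:
  "chern_coeff (Suc i) (d # ds) =
     chern_coeff (Suc i) ds + chern_coeff i ds - real (d + 1) * chern_coeff i (d # ds)"
proof -
  have "fps_nth (total_chern (d # ds) * (1 + fps_const (real (d + 1)) * fps_X)) (Suc i) =
        fps_nth (total_chern ds * (1 + fps_X)) (Suc i)"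
    by (simp only: total_chern_Cons)
  then show ?thesis
    by (simp add: chern_coeff_def distrib_left mult.assoc[symmetric] mult.commute[of _ "fps_const _"]
        del: of_nat_add of_nat_Suc)
qed

lemma chern_coeff_Nil: "chern_coeff i [] = real (4 choose i)"
proof -
  have "(1 + fps_X :: real fps) ^ 4 = fps_binomial 4"
    using fps_binomial_of_nat[of 4, where 'a = real] by simp
  then show ?thesis
    using binomial_gbinomial[of 4 i, where 'a = real]
    by (simp add: chern_coeff_def total_chern_def)
qed

lemma chern_coeff_1: "chern_coeff 1 ds = 4 - power_sum 1 ds"
  by (induction ds)
    (simp_all add: power_sum_def chern_coeff_Nil chern_coeff_Cons chern_coeff_0)

lemma chern_coeff_2:
  "chern_coeff 2 ds =
     ((power_sum 1 ds)\<^sup>2 + power_sum 2 ds) / 2 - 3 * (power_sum 1 ds - 2)"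
proof (induction ds)
  case Nil
  then show ?case
    by (simp add: power_sum_def chern_coeff_Nil eval_nat_numeral)
next
  case (Cons d ds)
  have "chern_coeff 2 (d # ds) =
      chern_coeff 2 ds + chern_coeff 1 ds - real (d + 1) * chern_coeff 1 (d # ds)"
    using chern_coeff_Cons[of 1 d ds] by (simp add: eval_nat_numeral)
  then show ?case
    by (simp add: Cons.IH chern_coeff_1 chern_coeff_1[unfolded One_nat_def] power_sum_def field_simps power2_eq_square)
qed

lemma chern_coeff_3:
  "chern_coeff 3 ds =
     - (power_sum 1 ds ^ 3 + 3 * power_sum 1 ds * power_sum 2 ds + 2 * power_sum 3 ds) / 6
     + ((power_sum 1 ds)\<^sup>2 + power_sum 2 ds) - 3 * power_sum 1 ds + 4"
proof (induction ds)
  case Nil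
  then show ?case
    by (simp add: power_sum_def chern_coeff_Nil eval_nat_numeral)
next
  case (Cons d ds)
  have "chern_coeff 3 (d # ds) =
      chern_coeff 3 ds + chern_coeff 2 ds - real (d + 1) * chern_coeff 2 (d # ds)"
    using chern_coeff_Cons[of 2 d ds] by (simp add: eval_nat_numeral)
  then show ?case
    by (simp add: Cons.IH chern_coeff_2 power_sum_def field_simps power2_eq_square power3_eq_cube)
qed

end

theory Submission
  imports Defs
begin

text \<open>
  Put \<open>p = s\<^sub>1 - 4\<close>, so that \<open>c\<^sub>1 = - p\<close>. A line \<open>y = a + b x\<close> in the plane of Chern ratios pulls back
  to the cubic form \<open>- c\<^sub>3 = a p c\<^sub>2 + b p\<^sup>3\<close>, which is linear in \<open>s\<^sub>2\<close> and \<open>s\<^sub>3\<close>. The corners, ordered by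
  their first coordinate, form a convex chain that converges to \<open>(2, 1/3)\<close> and lies below the line
  from \<open>Q(1;5)\<close> to this limit. Hence it suffices that all points lie above every line through two
  consecutive corners and strictly below that last line. For the lower lines,
  \<open>s\<^sub>3 \<ge> s\<^sub>2\<^sup>2 / s\<^sub>1\<close> reduces the inequality to a quadratic in the excess \<open>s\<^sub>2 - s\<^sub>1\<close>; close to the corners
  the integrality of the degrees gives the sharper bounds \<open>s\<^sub>3 \<ge> (2k + 1) s\<^sub>2 - k (k + 1) s\<^sub>1\<close>. For the
  upper line, \<open>s\<^sub>3 \<le> s\<^sub>1 s\<^sub>2\<close> is enough.
\<close>

section \<open>Convex hulls of infinite convex chains in the plane\<close>

text \<open>A linear functional minimal at \<open>p\<close> on \<open>S\<close> is minimal there on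
  the hull, so it is constant on any segment of the hull with \<open>p\<close> in its interior. In
  the plane, \<open>f\<close> and \<open>g\<close> are normals of two supporting lines that meet
  only in \<open>p\<close>.\<close>

lemma extreme_point_of_convex_hull_inner:
  fixes S :: "'a::real_inner set"
  assumes "p \<in> S"
    and f: "\<And>q. q \<in> S \<Longrightarrow> inner f p \<le> inner f q"
    and g: "\<And>q. q \<in> S \<Longrightarrow> inner g p \<le> inner g q"
    and eq: "\<And>q. inner f q = inner f p \<Longrightarrow> inner g q = inner g p \<Longrightarrow> q = p"
  shows "p extreme_point_of (convex hull S)"
proof -
  have f': "inner f p \<le> inner f q" if "q \<in> convex hull S" for q
    using hull_minimal[of S "{q. inner f q \<ge> inner f p}" convex] convex_halfspace_ge f that by auto
  have g': "inner g p \<le> inner g q" if "q \<in> convex hull S" for q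
    using hull_minimal[of S "{q. inner g q \<ge> inner g p}" convex] convex_halfspace_ge g that by auto
  have balance: "x = z" if "z = (1 - u) * x + u * y" "z \<le> x" "z \<le> y" "0 < u" "u < 1" for x y z u :: real
  proof -
    have "(1 - u) * (x - z) + u * (y - z) = 0"
      using that(1) by (simp add: algebra_simps)
    moreover have "0 \<le> (1 - u) * (x - z)" "0 \<le> u * (y - z)"
      using that by auto
    ultimately have "(1 - u) * (x - z) = 0"
      by linarith
    then show ?thesis
      using that by simp
  qed
  have "p \<notin> open_segment x y" if x: "x \<in> convex hull S" and y: "y \<in> convex hull S" for x y
  proof
    assume "p \<in> open_segment x y"
    then obtain u where ne: "x \<noteq> y" and u: "0 < u" "u < 1" and p: "p = (1 - u) *\<^sub>R x + u *\<^sub>R y"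
      by (auto simp: in_segment)
    have pf: "inner h p = (1 - u) * inner h x + u * inner h y" for h
      by (simp add: p inner_add_right)
    have "inner f x = inner f p" "inner g x = inner g p"
      using balance[OF pf _ _ u] f' g' x y by auto
    then have "x = p"
      by (rule eq)
    then have "u *\<^sub>R x = u *\<^sub>R y"
      using p by (simp add: algebra_simps)
    then show False
      using u ne by simp
  qed
  then show ?thesis
    using \<open>p \<in> S\<close> by (auto simp: extreme_point_of_def hull_inc)
qed

lemma convex_chord_mem:
  fixes H :: "(real \<times> real) set"
  assumes "convex H" "A \<in> H" "B \<in> H" "fst A \<le> x" "x \<le> fst B" "fst A < fst B"
  shows "(x, snd A + (snd B - snd A) * (x - fst A) / (fst B - fst A)) \<in> H"
proof -
  define u where "u = (x - fst A) / (fst B - fst A)"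
  have u: "0 \<le> u" "u \<le> 1" "u * (fst B - fst A) = x - fst A"
    using assms by (auto simp: u_def)
  have "(1 - u) *\<^sub>R A + u *\<^sub>R B \<in> H"
    using assms u by (intro convexD_alt)
  also have "(1 - u) *\<^sub>R A + u *\<^sub>R B = (x, snd A + (snd B - snd A) * u)"
    using u(3) by (cases A; cases B) (simp add: algebra_simps)
  finally show ?thesis
    by (simp add: u_def)
qed

lemma convex_vertical_mem:
  fixes H :: "(real \<times> real) set"
  assumes "convex H" "(x, y1) \<in> H" "(x, y2) \<in> H" "y1 \<le> y" "y \<le> y2"
  shows "(x, y) \<in> H"
proof (cases "y1 = y2")
  case False
  define u where "u = (y - y1) / (y2 - y1)"
  have u: "0 \<le> u" "u \<le> 1" "u * (y2 - y1) = y - y1"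
    using assms False by (auto simp: u_def)
  have "(1 - u) *\<^sub>R (x, y1) + u *\<^sub>R (x, y2) \<in> H"
    using assms u by (intro convexD_alt)
  also have "(1 - u) *\<^sub>R (x, y1) + u *\<^sub>R (x, y2) = (x, y)"
    using u(3) by (simp add: algebra_simps)
  finally show ?thesis .
qed (use assms in auto)

text \<open>Each \<open>q\<close> in \<open>S\<close> other than \<open>v 0\<close> lies between an
  edge of the chain below it and a chord from \<open>v 0\<close> to some far \<open>v N\<close>
  above it, hence on a vertical segment of the hull. The cap inequality is strict so that it passes
  from the limit, which is not assumed to lie in the hull, to a finite \<open>N\<close>.\<close>

lemma convex_hull_chain:
  fixes v :: "nat \<Rightarrow> real \<times> real" and S :: "(real \<times> real) set"
  assumes inc: "\<And>k. fst (v k) < fst (v (Suc k))"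
    and edge: "\<And>k. \<exists>a b. snd (v k) = a + b * fst (v k) \<and> snd (v (Suc k)) = a + b * fst (v (Suc k)) \<and>
                 snd (v (Suc (Suc k))) \<noteq> a + b * fst (v (Suc (Suc k))) \<and> (\<forall>q\<in>S. a + b * fst q \<le> snd q)"
    and lim: "v \<longlonglongrightarrow> (X, Y)"
    and sub: "range v \<subseteq> S"
    and cap: "\<And>q. q \<in> S \<Longrightarrow> q = v 0 \<or> fst (v 0) < fst q \<and> fst q < X \<and>
                (snd q - snd (v 0)) * (X - fst (v 0)) < (Y - snd (v 0)) * (fst q - fst (v 0))"
  shows "convex hull S = convex hull (range v)"
    and "{x. x extreme_point_of (convex hull S)} = range v"
proof -
  obtain a b where ab0: "\<And>k. snd (v k) = a k + b k * fst (v k)"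
    and ab1: "\<And>k. snd (v (Suc k)) = a k + b k * fst (v (Suc k))"
    and strict: "\<And>k. snd (v (Suc (Suc k))) \<noteq> a k + b k * fst (v (Suc (Suc k)))"
    and above: "\<And>k q. q \<in> S \<Longrightarrow> a k + b k * fst q \<le> snd q"
    using edge by metis
  have mono: "strict_mono (\<lambda>k. fst (v k))"
    using inc by (simp add: strict_mono_Suc_iff)
  have limx: "(\<lambda>k. fst (v k)) \<longlonglongrightarrow> X" and limy: "(\<lambda>k. snd (v k)) \<longlonglongrightarrow> Y"
    using tendsto_fst[OF lim] tendsto_snd[OF lim] by auto
  have "q \<in> convex hull (range v)" if q: "q \<in> S" "q \<noteq> v 0" for q
  proof -
    define H where "H = convex hull (range v)"
    have H: "convex H" "\<And>k. v k \<in> H"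
      by (auto simp: H_def hull_inc)
    have x: "fst (v 0) < fst q" "fst q < X"
      and cap': "(snd q - snd (v 0)) * (X - fst (v 0)) < (Y - snd (v 0)) * (fst q - fst (v 0))"
      using cap[OF q(1)] q(2) by auto
    define m where "m = (LEAST k. fst q < fst (v k))"
    have ex: "\<exists>k. fst q < fst (v k)"
      using order_tendstoD(1)[OF limx x(2)] by (auto simp: eventually_sequentially)
    then have m: "fst q < fst (v m)"
      unfolding m_def by (rule LeastI_ex)
    with x obtain k where k: "m = Suc k"
      by (cases m) auto
    have xk: "fst (v k) \<le> fst q"
      using not_less_Least[of k "\<lambda>k. fst q < fst (v k)"] k m_def by force
    have "(fst q, snd (v k) + (snd (v m) - snd (v k)) * (fst q - fst (v k)) / (fst (v m) - fst (v k))) \<in> H"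
      using convex_chord_mem[OF H(1) H(2) H(2)] xk m inc k by simp
    also have "snd (v k) + (snd (v m) - snd (v k)) * (fst q - fst (v k)) / (fst (v m) - fst (v k)) = a k + b k * fst q"
    proof -
      have "snd (v m) - snd (v k) = b k * (fst (v m) - fst (v k))"
        using ab0 ab1 k by (simp add: algebra_simps)
      moreover have "fst (v m) - fst (v k) \<noteq> 0"
        using xk m by simp
      ultimately have "(snd (v m) - snd (v k)) * (fst q - fst (v k)) / (fst (v m) - fst (v k)) =
          b k * (fst q - fst (v k))"
        by simp
      then show ?thesis
        using ab0[of k] by (simp only:) (simp add: algebra_simps)
    qed
    finally have low: "(fst q, a k + b k * fst q) \<in> H" .
    have "(\<lambda>N. (snd (v N) - snd (v 0)) * (fst q - fst (v 0)) - (snd q - snd (v 0)) * (fst (v N) - fst (v 0)))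
        \<longlonglongrightarrow> (Y - snd (v 0)) * (fst q - fst (v 0)) - (snd q - snd (v 0)) * (X - fst (v 0))"
      by (intro tendsto_intros limx limy)
    then have "eventually (\<lambda>N. 0 < (snd (v N) - snd (v 0)) * (fst q - fst (v 0)) -
        (snd q - snd (v 0)) * (fst (v N) - fst (v 0))) sequentially"
      using cap' by (intro order_tendstoD(1)) auto
    then have "eventually (\<lambda>N. 0 < (snd (v N) - snd (v 0)) * (fst q - fst (v 0)) -
        (snd q - snd (v 0)) * (fst (v N) - fst (v 0)) \<and> fst q < fst (v N)) sequentially"
      using order_tendstoD(1)[OF limx x(2)] by eventually_elim auto
    from eventually_happens'[OF sequentially_bot this] obtain N where
      "0 < (snd (v N) - snd (v 0)) * (fst q - fst (v 0)) - (snd q - snd (v 0)) * (fst (v N) - fst (v 0)) \<and>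
       fst q < fst (v N)" ..
    then have N: "fst q < fst (v N)"
      "(snd q - snd (v 0)) * (fst (v N) - fst (v 0)) \<le> (snd (v N) - snd (v 0)) * (fst q - fst (v 0))"
      by linarith+
    have top: "(fst q, snd (v 0) + (snd (v N) - snd (v 0)) * (fst q - fst (v 0)) / (fst (v N) - fst (v 0))) \<in> H"
      using convex_chord_mem[OF H(1) H(2) H(2)] x N by simp
    have "snd q - snd (v 0) \<le> (snd (v N) - snd (v 0)) * (fst q - fst (v 0)) / (fst (v N) - fst (v 0))"
      using x N by (simp add: pos_le_divide_eq)
    then have "(fst q, snd q) \<in> H"
      using above[OF q(1), of k] by (intro convex_vertical_mem[OF H(1) low top]) linarith+
    then show ?thesis
      by (simp add: H_def)
  qed
  then have "S \<subseteq> convex hull (range v)"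
    by (metis hull_inc rangeI subsetI)
  then show hull: "convex hull S = convex hull (range v)"
    using sub by (metis hull_mono hull_minimal convex_convex_hull subset_antisym)
  have "v k extreme_point_of (convex hull S)" for k
  proof (cases k)
    case 0
    \<comment> \<open>Only one edge starts at \<open>v 0\<close>; the second supporting line is
      vertical.\<close>
    show ?thesis
    proof (rule extreme_point_of_convex_hull_inner[where f = "(1, 0)" and g = "(- b 0, 1)"])
      fix q assume "q \<in> S"
      then show "inner (1, 0) (v k) \<le> inner (1, 0) q"
        using cap[of q] 0 by (auto simp: inner_prod_def)
      show "inner (- b 0, 1) (v k) \<le> inner (- b 0, 1) q"
        using above[OF \<open>q \<in> S\<close>, of 0] ab0[of 0] 0 by (simp add: inner_prod_def)
    next
      fix q :: "real \<times> real" assume "inner (1, 0) q = inner (1, 0) (v k)" "inner (- b 0, 1) q = inner (- b 0, 1) (v k)"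
      then show "q = v k"
        by (simp add: inner_prod_def prod_eq_iff)
    qed (use sub in auto)
  next
    case (Suc l)
    \<comment> \<open>Equal slopes would put three consecutive vertices on one line, against
      \<open>strict\<close>.\<close>
    have ne: "b l \<noteq> b k"
      using ab0[of k] ab1[of k] ab1[of l] strict[of l] Suc by auto
    show ?thesis
    proof (rule extreme_point_of_convex_hull_inner[where f = "(- b l, 1)" and g = "(- b k, 1)"])
      fix q assume "q \<in> S"
      show "inner (- b l, 1) (v k) \<le> inner (- b l, 1) q"
        using above[OF \<open>q \<in> S\<close>, of l] ab1[of l] Suc by (simp add: inner_prod_def)
      show "inner (- b k, 1) (v k) \<le> inner (- b k, 1) q"
        using above[OF \<open>q \<in> S\<close>, of k] ab0[of k] by (simp add: inner_prod_def)
    next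
      fix q :: "real \<times> real" assume "inner (- b l, 1) q = inner (- b l, 1) (v k)" "inner (- b k, 1) q = inner (- b k, 1) (v k)"
      then have "snd q - snd (v k) = b l * (fst q - fst (v k))" "snd q - snd (v k) = b k * (fst q - fst (v k))"
        by (simp_all add: inner_prod_def algebra_simps)
      then show "q = v k"
        using ne by (simp add: prod_eq_iff)
    qed (use sub in auto)
  qed
  moreover have "x \<in> range v" if "x extreme_point_of (convex hull S)" for x
    using that extreme_point_of_convex_hull unfolding hull by blast
  ultimately show "{x. x extreme_point_of (convex hull S)} = range v"
    by auto
qed

section \<open>Chern ratios and lines in the plane\<close>

text \<open>
  For \<open>D > 0\<close>, the form is nonnegative iff the point with \<open>s\<^sub>1 = s\<close>, \<open>s\<^sub>2 = t\<close>, \<open>s\<^sub>3 = u\<close> lies on or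
  above the line \<open>y = \<alpha> / D + \<beta> / (6 D) x\<close>. It is linear in \<open>u\<close>.
\<close>

definition line_form :: "real \<Rightarrow> real \<Rightarrow> real \<Rightarrow> real \<Rightarrow> real \<Rightarrow> real \<Rightarrow> real" where
  "line_form D \<alpha> \<beta> s t u =
     D * (s ^ 3 + 3 * s * t + 2 * u - 6 * s\<^sup>2 - 6 * t + 18 * s - 24)
     - (3 * \<alpha> * (s - 4) * (s\<^sup>2 + t - 6 * s + 12) + \<beta> * (s - 4) ^ 3)"

definition general_type :: "nat list \<Rightarrow> bool" where
  "general_type ds \<longleftrightarrow> length ds \<ge> 1 \<and> (\<forall>d \<in> set ds. d \<ge> 1) \<and> sum_list ds \<ge> 5"

lemma general_type_ratios_eq: "general_type_ratios = chern_ratios ` {ds. general_type ds}"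
  by (auto simp: general_type_ratios_def general_type_def)

section \<open>Inequalities between power sums\<close>

lemma power_sum_1: "power_sum 1 ds = real (sum_list ds)"
  by (induction ds) (simp_all add: power_sum_def)

lemma power_sum_Cons: "power_sum i (d # ds) = real d ^ i + power_sum i ds"
  by (simp add: power_sum_def)

lemma power_sum_nonneg: "0 \<le> power_sum i ds"
  by (induction ds) (simp_all add: power_sum_def)

lemma power_sum_1_le_2:
  assumes "\<forall>d\<in>set ds. d \<ge> 1"
  shows "power_sum 1 ds \<le> power_sum 2 ds"
  using assms
proof (induction ds)
  case (Cons d ds)
  have "real d ^ 1 \<le> real d ^ 2"
    using Cons.prems by (intro power_increasing) auto
  moreover have "power_sum 1 ds \<le> power_sum 2 ds"
    using Cons by simp
  ultimately show ?case
    unfolding power_sum_Cons by linarith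
qed (simp add: power_sum_def)

lemma power_sum_2_le: "power_sum 2 ds \<le> (power_sum 1 ds)\<^sup>2"
proof (induction ds)
  case (Cons d ds)
  have "0 \<le> real d * power_sum 1 ds"
    by (simp add: power_sum_nonneg)
  then show ?case
    using Cons by (simp add: power_sum_Cons power2_eq_square algebra_simps)
qed (simp add: power_sum_def)

lemma power_sum_3_le: "power_sum 3 ds \<le> power_sum 1 ds * power_sum 2 ds"
proof (induction ds)
  case (Cons d ds)
  have "0 \<le> real d * power_sum 2 ds" "0 \<le> real d ^ 2 * power_sum 1 ds"
    by (simp_all add: power_sum_nonneg)
  then show ?case
    using Cons by (simp add: power_sum_Cons power2_eq_square power3_eq_cube algebra_simps)
qed (simp add: power_sum_def)

lemma power_sum_Cauchy_Schwarz: "(power_sum 2 ds)\<^sup>2 \<le> power_sum 3 ds * power_sum 1 ds"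
proof (induction ds)
  case (Cons d ds)
  \<comment> \<open>This is the sum of \<open>x * (c - x)^2\<close> over the entries
    \<open>x\<close>; the induction step needs it with \<open>c\<close> the new head.\<close>
  have "0 \<le> c\<^sup>2 * power_sum 1 ds - 2 * c * power_sum 2 ds + power_sum 3 ds" for c
  proof (induction ds)
    case (Cons d ds)
    have "0 \<le> real d * (c - real d)\<^sup>2"
      by simp
    then show ?case
      using Cons by (simp add: power_sum_Cons power2_eq_square power3_eq_cube algebra_simps)
  qed (simp add: power_sum_def)
  then have "0 \<le> real d * ((real d)\<^sup>2 * power_sum 1 ds - 2 * real d * power_sum 2 ds + power_sum 3 ds)"
    by simp
  then show ?case
    using Cons by (simp add: power_sum_Cons power2_eq_square power3_eq_cube algebra_simps)
qed (simp add: power_sum_def)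

text \<open>
  No natural number lies strictly between \<open>k\<close> and \<open>k + 1\<close>, so \<open>d (d - k) (d - k - 1) \<ge> 0\<close>. For lists
  with entries in \<open>{k, k + 1}\<close> this is sharper than Cauchy-Schwarz.
\<close>

lemma power_sum_3_ge:
  fixes k :: nat
  shows "(2 * real k + 1) * power_sum 2 ds - real k * (real k + 1) * power_sum 1 ds \<le> power_sum 3 ds"
proof (induction ds)
  case (Cons d ds)
  have "0 \<le> (real d - real k) * (real d - real k - 1)"
    by (cases "d \<le> k") (auto intro: mult_nonpos_nonpos)
  then have "0 \<le> real d * ((real d - real k) * (real d - real k - 1))"
    by simp
  then show ?case
    using Cons by (simp add: power_sum_Cons power2_eq_square power3_eq_cube algebra_simps)
qed (simp add: power_sum_def)

text \<open>The quantity is twice the second Chern coefficient; its sign allows denominators to be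
  cleared.\<close>

lemma second_chern_pos:
  fixes s t :: real
  assumes "5 \<le> s" "s \<le> t"
  shows "0 < s\<^sup>2 + t - 6 * s + 12"
proof -
  have "s\<^sup>2 + t - 6 * s + 12 = (s - 5) * s + (t - s) + 12"
    by (simp add: power2_eq_square algebra_simps)
  moreover have "0 \<le> (s - 5) * s"
    using assms by simp
  ultimately show ?thesis
    using assms by linarith
qed

lemma chern_ratios_eq:
  fixes ds defines "s \<equiv> power_sum 1 ds" and "t \<equiv> power_sum 2 ds" and "u \<equiv> power_sum 3 ds"
  assumes "general_type ds"
  shows "chern_ratios ds = (2 * (s - 4)\<^sup>2 / (s\<^sup>2 + t - 6 * s + 12),
      (s ^ 3 + 3 * s * t + 2 * u - 6 * s\<^sup>2 - 6 * t + 18 * s - 24) /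
      (3 * (s - 4) * (s\<^sup>2 + t - 6 * s + 12)))"
proof -
  have deg: "ci_degree ds \<noteq> 0"
    by (induction ds) (auto simp: ci_degree_def)
  have s: "5 \<le> s" and t: "s \<le> t"
    using assms power_sum_1_le_2[of ds] unfolding s_def power_sum_1
    by (auto simp: general_type_def)
  define c where "c = s\<^sup>2 + t - 6 * s + 12"
  have c: "0 < c"
    using second_chern_pos[OF s t] by (simp add: c_def)
  have 1: "chern_coeff 1 ds = - (s - 4)" and 2: "chern_coeff 2 ds = c / 2"
    and 3: "chern_coeff 3 ds = - (s ^ 3 + 3 * s * t + 2 * u - 6 * s\<^sup>2 - 6 * t + 18 * s - 24) / 6"
    unfolding chern_coeff_1 chern_coeff_2 chern_coeff_3 s_def t_def u_def c_def
    by (simp_all add: field_simps)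
  have "s - 4 \<noteq> 0"
    using s by simp
  then show ?thesis
    using c deg
    by (simp add: chern_ratios_def chern_number_111_def chern_number_12_def chern_number_3_def
        1 2 3 flip: c_def One_nat_def)
      (simp add: field_simps power2_eq_square power3_eq_cube)
qed

text \<open>Clearing denominators multiplies by a positive factor, so the sign of a polynomial in
  the power sums decides the side of the line.\<close>

lemma line_form_chern_ratios:
  assumes "general_type ds" "0 < D"
  shows "\<exists>c>0. line_form D \<alpha> \<beta> (power_sum 1 ds) (power_sum 2 ds) (power_sum 3 ds) =
    c * (snd (chern_ratios ds) - (\<alpha> / D + \<beta> / (6 * D) * fst (chern_ratios ds)))"
proof -
  define s where "s = power_sum 1 ds"
  define t where "t = power_sum 2 ds"
  define u where "u = power_sum 3 ds"
  define c where "c = s\<^sup>2 + t - 6 * s + 12"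
  define n where "n = s ^ 3 + 3 * s * t + 2 * u - 6 * s\<^sup>2 - 6 * t + 18 * s - 24"
  have s: "5 \<le> s" and t: "s \<le> t"
    using assms power_sum_1_le_2[of ds] unfolding s_def t_def power_sum_1
    by (auto simp: general_type_def)
  have c: "0 < c"
    using second_chern_pos[OF s t] by (simp add: c_def)
  have "chern_ratios ds = (2 * (s - 4)\<^sup>2 / c, n / (3 * (s - 4) * c))"
    using chern_ratios_eq[OF assms(1)] by (simp add: s_def t_def u_def c_def n_def)
  moreover have "line_form D \<alpha> \<beta> s t u = D * n - (3 * \<alpha> * (s - 4) * c + \<beta> * (s - 4) ^ 3)"
    by (simp add: line_form_def c_def n_def)
  moreover have "s - 4 \<noteq> 0"
    using s by simp
  ultimately have "line_form D \<alpha> \<beta> s t u =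
      3 * (s - 4) * c * D * (snd (chern_ratios ds) - (\<alpha> / D + \<beta> / (6 * D) * fst (chern_ratios ds)))"
    using c assms(2) by (simp add: divide_simps) (simp add: algebra_simps power2_eq_square power3_eq_cube)
  moreover have "0 < 3 * (s - 4) * c * D"
    using s c assms(2) by simp
  ultimately show ?thesis
    unfolding s_def t_def u_def by blast
qed

section \<open>The lines through consecutive corners\<close>

lemma line_form_ones:
  "line_form D \<alpha> \<beta> (p + 4) (p + 4) (p + 4) =
     D * (p ^ 3 + 9 * p\<^sup>2 + 38 * p + 48) - 3 * \<alpha> * p * (p\<^sup>2 + 3 * p + 8) - \<beta> * p ^ 3"
  by (simp add: line_form_def algebra_simps power2_eq_square power3_eq_cube)

text \<open>Expansion about the list of \<open>p + 4\<close> ones, all of whose power sums are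
  \<open>p + 4\<close>.\<close>

lemma line_form_excess:
  "line_form D \<alpha> \<beta> (p + 4) (p + 4 + e) u =
     line_form D \<alpha> \<beta> (p + 4) (p + 4) (p + 4) + e * (D * (3 * p + 6) - 3 * \<alpha> * p) + 2 * D * (u - (p + 4))"
  by (simp add: line_form_def algebra_simps power2_eq_square power3_eq_cube)

text \<open>
  With \<open>s\<^sub>3\<close> replaced by its Cauchy-Schwarz bound the form is a quadratic in the excess \<open>e\<close>, and
  the last assumption says that its discriminant is not positive.
\<close>

lemma line_form_nonneg_quadratic:
  assumes "0 < p" "0 < D" "0 \<le> e"
    and u: "(p + 4 + e)\<^sup>2 \<le> u * (p + 4)"
    and base: "0 \<le> line_form D \<alpha> \<beta> (p + 4) (p + 4) (p + 4)"
    and r: "- r \<le> D * (3 * p + 10) - 3 * \<alpha> * p"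
    and disc: "r\<^sup>2 * (p + 4) \<le> 8 * D * line_form D \<alpha> \<beta> (p + 4) (p + 4) (p + 4)"
  shows "0 \<le> line_form D \<alpha> \<beta> (p + 4) (p + 4 + e) u"
proof -
  define s where "s = p + 4"
  define c where "c = line_form D \<alpha> \<beta> (p + 4) (p + 4) (p + 4)"
  have s: "0 < s"
    using assms(1) by (simp add: s_def)
  \<comment> \<open>Completing the square in \<open>e\<close>.\<close>
  have "0 \<le> (4 * D * e - s * r)\<^sup>2 + s * (8 * D * c - r\<^sup>2 * s)"
    using disc s by (simp add: s_def c_def)
  also have "\<dots> = 8 * D * (s * c - s * e * r + 2 * D * e\<^sup>2)"
    by (simp add: power2_eq_square algebra_simps)
  finally have "0 \<le> s * c - s * e * r + 2 * D * e\<^sup>2"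
    using assms(2) by (simp add: zero_le_mult_iff)
  moreover have "s * e * (- r) \<le> s * e * (D * (3 * p + 10) - 3 * \<alpha> * p)"
    using r s assms(3) by (intro mult_left_mono) auto
  \<comment> \<open>To first order in \<open>e\<close>, the bound on \<open>u\<close> adds
    \<open>4 * D * e\<close> to the form: this turns the \<open>3 * p + 6\<close> of
    \<open>line_form_excess\<close> into \<open>3 * p + 10\<close>.\<close>
  moreover have "D * (2 * e * s + e\<^sup>2) \<le> D * (u * s - s\<^sup>2)"
    using u assms(2) by (intro mult_left_mono) (simp_all add: s_def power2_eq_square algebra_simps)
  ultimately have "0 \<le> s * c + s * e * (D * (3 * p + 6) - 3 * \<alpha> * p) + 2 * D * (u * s - s\<^sup>2)"
    by (simp add: algebra_simps)
  also have "\<dots> = s * line_form D \<alpha> \<beta> (p + 4) (p + 4 + e) u"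
    unfolding line_form_excess[of _ _ _ _ e] by (simp add: c_def s_def power2_eq_square algebra_simps)
  finally show ?thesis
    using s by (simp add: zero_le_mult_iff)
qed

text \<open>The bound says that \<open>u - (p + 4)\<close> is at least \<open>3 * e\<close>, which
  raises \<open>3 * p + 6\<close> to \<open>3 * p + 12\<close>. The form is then nonnegative even if
  its value at the ones vanishes.\<close>

lemma line_form_nonneg_linear:
  assumes "0 < D" "0 \<le> e"
    and u: "3 * (p + 4 + e) - 2 * (p + 4) \<le> u"
    and base: "0 \<le> line_form D \<alpha> \<beta> (p + 4) (p + 4) (p + 4)"
    and r: "3 * \<alpha> * p \<le> D * (3 * p + 12)"
  shows "0 \<le> line_form D \<alpha> \<beta> (p + 4) (p + 4 + e) u"
proof -
  have "D * (3 * e) \<le> D * (u - (p + 4))"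
    using u assms(1) by (intro mult_left_mono) auto
  moreover have "0 \<le> e * (D * (3 * p + 12) - 3 * \<alpha> * p)"
    using assms by simp
  ultimately show ?thesis
    using base unfolding line_form_excess[of _ _ _ _ e] by (simp add: algebra_simps)
qed

text \<open>
  The coefficients of the line through the points of \<open>1\<^sup>m\<^sup>+\<^sup>4\<close> and \<open>1\<^sup>m\<^sup>+\<^sup>5\<close>, in the form used
  by \<^const>\<open>line_form\<close>.
\<close>

definition tail_D :: "real \<Rightarrow> real" where
  "tail_D m = 9 * m ^ 4 + 66 * m ^ 3 + 81 * m\<^sup>2 + 24 * m"

definition tail_\<alpha> :: "real \<Rightarrow> real" where
  "tail_\<alpha> m = 9 * m ^ 4 + 94 * m ^ 3 + 267 * m\<^sup>2 + 182 * m + 48"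

definition tail_\<beta> :: "real \<Rightarrow> real" where
  "tail_\<beta> m = - (18 * m ^ 4 + 216 * m ^ 3 + 846 * m\<^sup>2 + 1512 * m + 1728)"

text \<open>The roots \<open>m\<close> and \<open>m + 1\<close> belong to the two corners on the
  line; the last factor is positive for positive \<open>m\<close> and \<open>p\<close>.\<close>

lemma tail_line_ones:
  "line_form (tail_D m) (tail_\<alpha> m) (tail_\<beta> m) (p + 4) (p + 4) (p + 4) =
     (p - m) * (p - m - 1) *
     (126 * m\<^sup>2 * p + 990 * m * p + 432 * m\<^sup>2 + 2736 * m + 1584 * p + 1152)"
  unfolding line_form_ones tail_D_def tail_\<alpha>_def tail_\<beta>_def
  by (simp add: algebra_simps power2_eq_square power3_eq_cube power4_eq_xxxx)

text \<open>In terms of the gap \<open>k\<close> all coefficients are positive. The next slope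
  lemmas shift by \<open>m = i + 2\<close> for the same effect.\<close>

lemma tail_slope_before:
  fixes p k :: real
  assumes "0 \<le> p" "0 \<le> k"
  shows "0 \<le> tail_D (p + 1 + k) * (3 * p + 10) - 3 * tail_\<alpha> (p + 1 + k) * p"
proof -
  have "tail_D (p + 1 + k) * (3 * p + 10) - 3 * tail_\<alpha> (p + 1 + k) * p =
    108 * k * p ^ 3 + 288 * k ^ 2 * p ^ 2 + 276 * k ^ 3 * p + 90 * k ^ 4 + 6 * p ^ 4
     + 1440 * k * p ^ 2 + 2250 * k ^ 2 * p + 1020 * k ^ 3 + 210 * p ^ 3 + 4818 * k * p
     + 3330 * k ^ 2 + 1488 * p ^ 2 + 4200 * k + 2940 * p + 1800"
    unfolding tail_D_def tail_\<alpha>_def by algebra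
  then show ?thesis
    using assms by simp
qed

lemma tail_slope_left:
  fixes i :: real
  assumes "0 \<le> i"
  shows "3 * tail_\<alpha> (i + 2) * (i + 2) \<le> tail_D (i + 2) * (3 * (i + 2) + 12)"
proof -
  have "tail_D (i + 2) * (3 * (i + 2) + 12) - 3 * tail_\<alpha> (i + 2) * (i + 2) =
    24 * i ^ 4 + 426 * i ^ 3 + 2478 * i ^ 2 + 5712 * i + 4536"
    unfolding tail_D_def tail_\<alpha>_def by algebra
  moreover have "0 \<le> \<dots>"
    using assms by simp
  ultimately show ?thesis
    by linarith
qed

lemma tail_slope_right:
  fixes i :: real
  assumes "0 \<le> i"
  shows "3 * tail_\<alpha> (i + 2) * (i + 3) \<le> tail_D (i + 2) * (3 * (i + 3) + 12)"
proof -
  have "tail_D (i + 2) * (3 * (i + 3) + 12) - 3 * tail_\<alpha> (i + 2) * (i + 3) =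
    24 * i ^ 4 + 342 * i ^ 3 + 1416 * i ^ 2 + 1998 * i + 540"
    unfolding tail_D_def tail_\<alpha>_def by algebra
  moreover have "0 \<le> \<dots>"
    using assms by simp
  ultimately show ?thesis
    by linarith
qed

text \<open>
  Up to the positive term \<open>6 m\<^sup>4\<close>, this is minus the linear coefficient of the quadratic at \<open>p = m + 2 + j\<close>.
  With that term included the discriminant would be positive for \<open>j = 0\<close> and large \<open>m\<close>.
\<close>

definition tail_r :: "real \<Rightarrow> real \<Rightarrow> real" where
  "tail_r m j = 66 * m ^ 3 + 780 * m\<^sup>2 + 852 * m + 288 + j * (84 * m ^ 3 + 558 * m\<^sup>2 + 474 * m + 144)"

lemma tail_slope_after:
  "- tail_r m j \<le> tail_D m * (3 * (m + 2 + j) + 10) - 3 * tail_\<alpha> m * (m + 2 + j)"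
proof -
  have "tail_D m * (3 * (m + 2 + j) + 10) - 3 * tail_\<alpha> m * (m + 2 + j) = 6 * m ^ 4 - tail_r m j"
    unfolding tail_D_def tail_\<alpha>_def tail_r_def by algebra
  then show ?thesis
    by simp
qed

text \<open>Written in the shifts \<open>i = m - 2\<close> and \<open>j = p - m - 2\<close>, the
  difference of the two sides has only positive coefficients.\<close>

lemma tail_discriminant:
  fixes i j :: real
  assumes "0 \<le> i" "0 \<le> j" and m: "m = i + 2" and p: "p = m + 2 + j"
  shows "(tail_r m j)\<^sup>2 * (p + 4) \<le>
    8 * tail_D m * line_form (tail_D m) (tail_\<alpha> m) (tail_\<beta> m) (p + 4) (p + 4) (p + 4)"
proof -
  have "8 * tail_D m * line_form (tail_D m) (tail_\<alpha> m) (tail_\<beta> m) (p + 4) (p + 4) (p + 4) -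
      (tail_r m j)\<^sup>2 * (p + 4) =
    2016 * i ^ 6 * j ^ 3 + 2016 * i ^ 7 * j ^ 2 + 68256 * i ^ 5 * j ^ 3 + 95328 * i ^ 6 * j ^ 2
     + 16128 * i ^ 7 * j + 889020 * i ^ 4 * j ^ 3 + 1648980 * i ^ 5 * j ^ 2 + 529524 * i ^ 6 * j
     + 13788 * i ^ 7 + 5653368 * i ^ 3 * j ^ 3 + 14260896 * i ^ 4 * j ^ 2 + 7125192 * i ^ 5 * j
     + 438048 * i ^ 6 + 18391500 * i ^ 2 * j ^ 3 + 67980348 * i ^ 3 * j ^ 2 + 50736672 * i ^ 4 * j
     + 5598000 * i ^ 5 + 29268432 * i * j ^ 3 + 179870976 * i ^ 2 * j ^ 2 + 206369424 * i ^ 3 * j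
     + 37358208 * i ^ 4 + 245933424 * i * j ^ 2 + 478947888 * i ^ 2 * j + 141303600 * i ^ 3
     + 18007920 * j ^ 3 + 586772352 * i * j + 303674688 * i ^ 2 + 134768448 * j ^ 2 + 343237824 * i
     + 292522176 * j + 156842496"
    unfolding tail_line_ones unfolding tail_D_def tail_r_def p m by algebra
  moreover have "0 \<le> \<dots>"
    using assms by simp
  ultimately show ?thesis
    by linarith
qed

text \<open>
  For \<open>p < m\<close> the quadratic has nonnegative coefficients, for \<open>p \<in> {m, m + 1}\<close> its constant term
  vanishes and the integral bound \<open>s\<^sub>3 \<ge> 3 s\<^sub>2 - 2 s\<^sub>1\<close> is used, and for \<open>p > m + 1\<close> its discriminant
  is not positive.
\<close>

lemma tail_line_nonneg:
  fixes m p :: nat and e u :: real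
  assumes m: "2 \<le> m" and p: "1 \<le> p" and e: "0 \<le> e"
    and CS: "(real p + 4 + e)\<^sup>2 \<le> u * (real p + 4)"
    and lin: "3 * (real p + 4 + e) - 2 * (real p + 4) \<le> u"
  shows "0 \<le> line_form (tail_D m) (tail_\<alpha> m) (tail_\<beta> m) (real p + 4) (real p + 4 + e) u"
proof -
  obtain i where i: "m = 2 + i"
    using m le_Suc_ex by blast
  have D: "0 < tail_D m"
    using m by (simp add: tail_D_def add_nonneg_pos)
  \<comment> \<open>No integer lies strictly between \<open>m\<close> and
    \<open>m + 1\<close>.\<close>
  have "0 \<le> (real p - real m) * (real p - real m - 1)"
    by (cases "p \<le> m") (auto intro: mult_nonpos_nonpos)
  then have base: "0 \<le> line_form (tail_D m) (tail_\<alpha> m) (tail_\<beta> m) (real p + 4) (real p + 4) (real p + 4)"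
    unfolding tail_line_ones by simp
  consider (before) k where "m = p + 1 + k" | (left) "p = m" | (right) "p = m + 1" | (after) j where "p = m + 2 + j"
    using le_Suc_ex[of "Suc p" m] le_Suc_ex[of "m + 2" p] by fastforce
  then show ?thesis
  proof cases
    case before
    then have mp: "real m = real p + 1 + real k"
      by simp
    have "0 \<le> tail_D m * (3 * real p + 10) - 3 * tail_\<alpha> m * real p"
      unfolding mp by (rule tail_slope_before) auto
    then show ?thesis
      using p D e CS base by (intro line_form_nonneg_quadratic[where r = 0]) auto
  next
    case left
    then have "3 * tail_\<alpha> m * real p \<le> tail_D m * (3 * real p + 12)"
      using tail_slope_left[of i] i by (simp add: add.commute)
    then show ?thesis
      by (intro line_form_nonneg_linear D e lin base)
  next
    case right
    then have "real m = real i + 2" "real p = real i + 3"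
      using i by auto
    then have "3 * tail_\<alpha> m * real p \<le> tail_D m * (3 * real p + 12)"
      using tail_slope_right[of i] by simp
    then show ?thesis
      by (intro line_form_nonneg_linear D e lin base)
  next
    case after
    then have pm: "real p = real m + 2 + real j" and mi: "real m = real i + 2"
      using i by auto
    show ?thesis
      using p D e CS base tail_slope_after[of m j, folded pm] tail_discriminant[OF _ _ mi pm]
      by (intro line_form_nonneg_quadratic[where r = "tail_r m j"]) auto
  qed
qed

section \<open>Position of the Chern ratios relative to the lines\<close>

lemma list_positive_cases:
  fixes ds :: "nat list"
  assumes "\<forall>d\<in>set ds. 1 \<le> d" "sum_list ds = Suc n"
  obtains d l where "ds = d # l" "1 \<le> d" "d \<le> Suc n" "sum_list l = Suc n - d" "\<forall>d\<in>set l. 1 \<le> d"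
  using assms by (cases ds) auto

lemma power_sums_of_sum_0:
  assumes "\<forall>d\<in>set ds. 1 \<le> d" "sum_list ds = 0"
  shows "power_sum 2 ds = 0" "power_sum 3 ds = 0"
  using assms by (cases ds; simp add: power_sum_def)+

lemma power_sums_of_sum_1:
  assumes "\<forall>d\<in>set ds. 1 \<le> d" "sum_list ds = 1"
  shows "(power_sum 2 ds, power_sum 3 ds) = (1, 1)"
proof -
  obtain d l where dl: "ds = d # l" "1 \<le> d" "d \<le> 1" "sum_list l = 1 - d" "\<forall>d\<in>set l. 1 \<le> d"
    using list_positive_cases[of ds 0] assms by (metis One_nat_def)
  then show ?thesis
    using power_sums_of_sum_0[of l] by (simp add: power_sum_Cons)
qed

lemma power_sums_of_sum_2:
  assumes "\<forall>d\<in>set ds. 1 \<le> d" "sum_list ds = 2"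
  shows "(power_sum 2 ds, power_sum 3 ds) \<in> {(2, 2), (4, 8)}"
proof -
  obtain d l where dl: "ds = d # l" "1 \<le> d" "d \<le> 2" "sum_list l = 2 - d" "\<forall>d\<in>set l. 1 \<le> d"
    using list_positive_cases[of ds 1] assms by (auto simp: numeral_2_eq_2)
  consider "d = 1" | "d = 2"
    using dl by linarith
  then show ?thesis
    using dl power_sums_of_sum_0[of l] power_sums_of_sum_1[of l]
    by cases (auto simp: power_sum_Cons)
qed

lemma power_sums_of_sum_3:
  assumes "\<forall>d\<in>set ds. 1 \<le> d" "sum_list ds = 3"
  shows "(power_sum 2 ds, power_sum 3 ds) \<in> {(3, 3), (5, 9), (9, 27)}"
proof -
  obtain d l where dl: "ds = d # l" "1 \<le> d" "d \<le> 3" "sum_list l = 3 - d" "\<forall>d\<in>set l. 1 \<le> d"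
    using list_positive_cases[of ds 2] assms by auto
  consider "d = 1" | "d = 2" | "d = 3"
    using dl by linarith
  then show ?thesis
    using dl power_sums_of_sum_0[of l] power_sums_of_sum_1[of l] power_sums_of_sum_2[of l]
    by cases (auto simp: power_sum_Cons)
qed

lemma power_sums_of_sum_4:
  assumes "\<forall>d\<in>set ds. 1 \<le> d" "sum_list ds = 4"
  shows "(power_sum 2 ds, power_sum 3 ds) \<in> {(4, 4), (6, 10), (8, 16), (10, 28), (16, 64)}"
proof -
  obtain d l where dl: "ds = d # l" "1 \<le> d" "d \<le> 4" "sum_list l = 4 - d" "\<forall>d\<in>set l. 1 \<le> d"
    using list_positive_cases[of ds 3] assms by auto
  consider "d = 1" | "d = 2" | "d = 3" | "d = 4"
    using dl by linarith
  then show ?thesis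
    using dl power_sums_of_sum_0[of l] power_sums_of_sum_1[of l] power_sums_of_sum_2[of l]
      power_sums_of_sum_3[of l]
    by cases (auto simp: power_sum_Cons)
qed

text \<open>One pair for each of the seven partitions of 5, four of which give corners. Splitting
  off the head reduces to smaller sums.\<close>

lemma power_sums_of_sum_5:
  assumes "\<forall>d\<in>set ds. 1 \<le> d" "sum_list ds = 5"
  shows "(power_sum 2 ds, power_sum 3 ds) \<in>
    {(5, 5), (7, 11), (9, 17), (11, 29), (13, 35), (17, 65), (25, 125)}"
proof -
  obtain d l where dl: "ds = d # l" "1 \<le> d" "d \<le> 5" "sum_list l = 5 - d" "\<forall>d\<in>set l. 1 \<le> d"
    using list_positive_cases[of ds 4] assms by auto
  consider "d = 1" | "d = 2" | "d = 3" | "d = 4" | "d = 5"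
    using dl by linarith
  then show ?thesis
    using dl power_sums_of_sum_0[of l] power_sums_of_sum_1[of l] power_sums_of_sum_2[of l]
      power_sums_of_sum_3[of l] power_sums_of_sum_4[of l]
    by cases (auto simp: power_sum_Cons)
qed

lemma general_type_power_sums:
  assumes "general_type ds"
  obtains p :: nat and e u :: real where
    "1 \<le> p" "0 \<le> e"
    "power_sum 1 ds = real p + 4" "power_sum 2 ds = real p + 4 + e" "power_sum 3 ds = u"
    "(real p + 4 + e)\<^sup>2 \<le> u * (real p + 4)"
    "3 * (real p + 4 + e) - 2 * (real p + 4) \<le> u"
    "5 * (real p + 4 + e) - 6 * (real p + 4) \<le> u"
    "real p + 4 + e \<le> (real p + 4)\<^sup>2"
    "u \<le> (real p + 4) * (real p + 4 + e)"
    "p = 1 \<Longrightarrow> (real p + 4 + e, u) \<in> {(5, 5), (7, 11), (9, 17), (11, 29), (13, 35), (17, 65), (25, 125)}"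
proof -
  define p where "p = sum_list ds - 4"
  define e where "e = power_sum 2 ds - (real p + 4)"
  have p: "1 \<le> p" "sum_list ds = p + 4"
    using assms by (auto simp: p_def general_type_def)
  have ds: "\<forall>d\<in>set ds. 1 \<le> d"
    using assms by (simp add: general_type_def)
  have s: "power_sum 1 ds = real p + 4" and t: "power_sum 2 ds = real p + 4 + e"
    using p(2) by (simp_all only: power_sum_1) (simp_all add: e_def)
  show ?thesis
  proof (rule that[OF p(1) _ s t refl])
    show "0 \<le> e"
      using power_sum_1_le_2[OF ds] s t by simp
    show "p = 1 \<Longrightarrow> (real p + 4 + e, power_sum 3 ds) \<in>
        {(5, 5), (7, 11), (9, 17), (11, 29), (13, 35), (17, 65), (25, 125)}"
      using power_sums_of_sum_5[OF ds] p(2) t by simp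
  qed (use power_sum_Cauchy_Schwarz[of ds] power_sum_3_ge[of 1 ds] power_sum_3_ge[of 2 ds]
      power_sum_2_le[of ds] power_sum_3_le[of ds] s t in simp_all)
qed

definition list_form :: "real \<Rightarrow> real \<Rightarrow> real \<Rightarrow> nat list \<Rightarrow> real" where
  "list_form D \<alpha> \<beta> ds = line_form D \<alpha> \<beta> (power_sum 1 ds) (power_sum 2 ds) (power_sum 3 ds)"

text \<open>
  Each corner line comes down to finitely many numerical checks: the partitions of \<open>5\<close> when
  \<open>s\<^sub>1 = 5\<close>, the linear bounds on \<open>s\<^sub>3\<close> when \<open>s\<^sub>1 = 6\<close>, and for \<open>s\<^sub>1 = 7 + i\<close> the signs of the
  coefficients of the value at \<open>1\<^sup>7\<^sup>+\<^sup>i\<close> and of the discriminant, as polynomials in \<open>i\<close>.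
\<close>

lemma list_form_nonnegI:
  fixes D \<alpha> \<beta> :: real
  defines "c3 \<equiv> D - 3 * \<alpha> - \<beta>" and "c2 \<equiv> 18 * D - 36 * \<alpha> - 9 * \<beta>"
    and "c1 \<equiv> 119 * D - 159 * \<alpha> - 27 * \<beta>" and "c0 \<equiv> 270 * D - 234 * \<alpha> - 27 * \<beta>"
    and "r1 \<equiv> 3 * \<alpha> - 3 * D" and "r0 \<equiv> 9 * \<alpha> - 19 * D"
  assumes ds: "general_type ds" and D: "0 < D"
    and five: "\<forall>(t, u) \<in> {(5, 5), (7, 11), (9, 17), (11, 29), (13, 35), (17, 65), (25, 125)}.
      0 \<le> line_form D \<alpha> \<beta> 5 t u"
    and six: "\<And>t u. 3 * t - 12 \<le> u \<Longrightarrow> 5 * t - 36 \<le> u \<Longrightarrow> t \<le> 36 \<Longrightarrow> 0 \<le> line_form D \<alpha> \<beta> 6 t u"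
    and c: "0 \<le> c3" "0 \<le> c2" "0 \<le> c1" "0 \<le> c0"
    and d: "0 \<le> 8 * D * c3 - r1\<^sup>2" "0 \<le> 8 * D * c2 - (7 * r1\<^sup>2 + 2 * r0 * r1)"
      "0 \<le> 8 * D * c1 - (14 * r0 * r1 + r0\<^sup>2)" "0 \<le> 8 * D * c0 - 7 * r0\<^sup>2"
  shows "0 \<le> list_form D \<alpha> \<beta> ds"
proof -
  obtain p e u where p: "1 \<le> p" and e: "0 \<le> e"
    and sums: "power_sum 1 ds = real p + 4" "power_sum 2 ds = real p + 4 + e" "power_sum 3 ds = u"
    and CS: "(real p + 4 + e)\<^sup>2 \<le> u * (real p + 4)"
    and lin: "3 * (real p + 4 + e) - 2 * (real p + 4) \<le> u"
      "5 * (real p + 4 + e) - 6 * (real p + 4) \<le> u" "real p + 4 + e \<le> (real p + 4)\<^sup>2"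
    and one: "p = 1 \<Longrightarrow> (real p + 4 + e, u) \<in>
      {(5, 5), (7, 11), (9, 17), (11, 29), (13, 35), (17, 65), (25, 125)}"
    using general_type_power_sums[OF ds] by metis
  consider "p = 1" | "p = 2" | i where "p = 3 + i"
    using p le_Suc_ex[of 3 p] by fastforce
  then have "0 \<le> line_form D \<alpha> \<beta> (real p + 4) (real p + 4 + e) u"
  proof cases
    case 1
    then show ?thesis
      using one five by auto
  next
    \<comment> \<open>The bounds are the cases \<open>k = 1\<close> and \<open>k = 2\<close> of
      \<open>power_sum_3_ge\<close>; both are equalities at the corner
      \<open>[2, 2, 2]\<close>.\<close>
    case 2
    then show ?thesis
      using lin six[of "6 + e" u] by simp
  next
    case (3 i)
    then have i: "real p = 3 + real i"
      by simp
    have base: "line_form D \<alpha> \<beta> (real p + 4) (real p + 4) (real p + 4) =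
        c3 * real i ^ 3 + c2 * (real i)\<^sup>2 + c1 * real i + c0"
      unfolding line_form_ones i c3_def c2_def c1_def c0_def by algebra
    have r: "D * (3 * real p + 10) - 3 * \<alpha> * real p = - (r1 * real i + r0)"
      unfolding i r1_def r0_def by algebra
    have "8 * D * line_form D \<alpha> \<beta> (real p + 4) (real p + 4) (real p + 4) -
        (r1 * real i + r0)\<^sup>2 * (real p + 4) =
        (8 * D * c3 - r1\<^sup>2) * real i ^ 3 + (8 * D * c2 - (7 * r1\<^sup>2 + 2 * r0 * r1)) * (real i)\<^sup>2 +
        (8 * D * c1 - (14 * r0 * r1 + r0\<^sup>2)) * real i + (8 * D * c0 - 7 * r0\<^sup>2)"
      unfolding base unfolding i by algebra
    moreover have "0 \<le> \<dots>"
      by (intro add_nonneg_nonneg mult_nonneg_nonneg d) auto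
    moreover have "0 \<le> line_form D \<alpha> \<beta> (real p + 4) (real p + 4) (real p + 4)"
      unfolding base by (intro add_nonneg_nonneg mult_nonneg_nonneg c) auto
    ultimately show ?thesis
      using p e CS D r by (intro line_form_nonneg_quadratic[where r = "r1 * real i + r0"]) auto
  qed
  then show ?thesis
    by (simp only: list_form_def sums)
qed

lemma list_form_nonneg_tail:
  fixes m :: nat
  assumes "general_type ds" "2 \<le> m"
  shows "0 \<le> list_form (tail_D m) (tail_\<alpha> m) (tail_\<beta> m) ds"
proof -
  obtain p e u where "1 \<le> p" "0 \<le> e"
    "power_sum 1 ds = real p + 4" "power_sum 2 ds = real p + 4 + e" "power_sum 3 ds = u"
    "(real p + 4 + e)\<^sup>2 \<le> u * (real p + 4)" "3 * (real p + 4 + e) - 2 * (real p + 4) \<le> u"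
    using general_type_power_sums[OF assms(1)] by metis
  then show ?thesis
    using tail_line_nonneg[OF assms(2)] by (simp only: list_form_def)
qed

text \<open>Ordered by first coordinate: \<open>[2, 2, 2]\<close> falls between five ones and six
  ones, so five ones sit at index 3 and the regular tail starts with six ones at index 5.\<close>

definition vertex :: "nat \<Rightarrow> nat list" where
  "vertex k = (if k < 5 then [[5], [2, 3], [1, 2, 2], [1, 1, 1, 1, 1], [2, 2, 2]] ! k else replicate (k + 1) 1)"

lemma vertex_simps:
  "vertex 0 = [5]" "vertex (Suc 0) = [2, 3]" "vertex 1 = [2, 3]" "vertex (Suc (Suc 0)) = [1, 2, 2]" "vertex 2 = [1, 2, 2]"
  "vertex 3 = [1, 1, 1, 1, 1]" "vertex 4 = [2, 2, 2]"
  by (simp_all add: vertex_def)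

lemma vertex_replicate: "5 \<le> k \<Longrightarrow> vertex k = replicate (k + 1) 1"
  by (simp add: vertex_def)

lemma less_5_cases: "(k::nat) < 5 \<longleftrightarrow> k = 0 \<or> k = 1 \<or> k = 2 \<or> k = 3 \<or> k = 4"
  by auto

lemma power_sum_replicate: "power_sum i (replicate n 1) = real n"
  by (induction n) (simp_all add: power_sum_def)

lemma general_type_vertex: "general_type (vertex k)"
proof (cases "k < 5")
  case True
  then show ?thesis
    unfolding less_5_cases by (auto simp: vertex_simps general_type_def)
next
  case False
  then show ?thesis
    by (simp add: vertex_replicate general_type_def sum_list_replicate)
qed

lemma corner_line:
  "\<exists>D \<alpha> \<beta>. 0 < D \<and> list_form D \<alpha> \<beta> (vertex k) = 0 \<and> list_form D \<alpha> \<beta> (vertex (Suc k)) = 0 \<and>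
     list_form D \<alpha> \<beta> (vertex (Suc (Suc k))) \<noteq> 0 \<and> (\<forall>ds. general_type ds \<longrightarrow> 0 \<le> list_form D \<alpha> \<beta> ds)"
proof -
  note simps = vertex_def list_form_def line_form_def power_sum_def sum_list_replicate
  consider "k = 0" | "k = 1" | "k = 2" | "k = 3" | "k = 4" | "5 \<le> k"
    using less_5_cases by fastforce
  then show ?thesis
  proof cases
    case 1
    \<comment> \<open>The witnesses in the first five cases encode the lines
      \<open>y = 8 - 42 x\<close>, \<open>6 - 22 x\<close>, \<open>5 - 14 x\<close>,
      \<open>41/12 - 9/2 x\<close> and \<open>3 - 13/4 x\<close>.\<close>
    show ?thesis
      by (rule exI[of _ 1], rule exI[of _ 8], rule exI[of _ "- 252"], intro conjI allI impI list_form_nonnegI)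
        (use 1 in \<open>auto simp: simps\<close>)
  next
    case 2
    show ?thesis
      by (rule exI[of _ 1], rule exI[of _ 6], rule exI[of _ "- 132"], intro conjI allI impI list_form_nonnegI)
        (use 2 in \<open>auto simp: simps\<close>)
  next
    case 3
    show ?thesis
      by (rule exI[of _ 1], rule exI[of _ 5], rule exI[of _ "- 84"], intro conjI allI impI list_form_nonnegI)
        (use 3 in \<open>auto simp: simps\<close>)
  next
    case 4
    show ?thesis
      by (rule exI[of _ 12], rule exI[of _ 41], rule exI[of _ "- 324"], intro conjI allI impI list_form_nonnegI)
        (use 4 in \<open>auto simp: simps\<close>)
  next
    case 5
    show ?thesis
      by (rule exI[of _ 2], rule exI[of _ 6], rule exI[of _ "- 39"], intro conjI allI impI list_form_nonnegI)
        (use 5 in \<open>auto simp: simps\<close>)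
  next
    case 6
    \<comment> \<open>\<open>vertex k\<close> consists of \<open>k + 1\<close> ones, and the tail
      line for \<open>m\<close> starts at \<open>m + 4\<close> ones.\<close>
    define m where "m = k - 3"
    have m: "2 \<le> m" and k: "k = m + 3"
      using 6 by (auto simp: m_def)
    have form: "list_form (tail_D m) (tail_\<alpha> m) (tail_\<beta> m) (vertex (k + j)) = real j * (real j - 1) *
        (126 * (real m)\<^sup>2 * real (m + j) + 990 * real m * real (m + j) + 432 * (real m)\<^sup>2 + 2736 * real m +
          1584 * real (m + j) + 1152)" for j
    proof -
      have "real (k + j + 1) = real (m + j) + 4"
        by (simp add: k)
      then show ?thesis
        using 6 unfolding list_form_def vertex_replicate[OF trans_le_add1[OF 6]] power_sum_replicate
        by (simp only: tail_line_ones) simp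
    qed
    have "0 < tail_D m"
      using m by (simp add: tail_D_def add_nonneg_pos)
    moreover have "list_form (tail_D m) (tail_\<alpha> m) (tail_\<beta> m) (vertex (Suc (Suc k))) > 0"
      using form[of 2] by (simp add: add_pos_nonneg)
    ultimately show ?thesis
      using form[of 0] form[of 1] list_form_nonneg_tail[OF _ m]
      by - (rule exI[of _ "tail_D m"], rule exI[of _ "tail_\<alpha> m"], rule exI[of _ "tail_\<beta> m"], auto)
  qed
qed

section \<open>Coordinates, order and limit of the corners\<close>

lemma chern_ratios_replicate:
  assumes "5 \<le> n"
  shows "chern_ratios (replicate n 1) =
    (2 * (real n - 4)\<^sup>2 / (real n ^ 2 - 5 * real n + 12),
     (real n ^ 3 - 3 * real n ^ 2 + 14 * real n - 24) / (3 * (real n - 4) * (real n ^ 2 - 5 * real n + 12)))"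
proof -
  have gt: "general_type (replicate n 1)"
    using assms by (simp add: general_type_def sum_list_replicate)
  have "real n ^ 2 + real n - 6 * real n + 12 = real n ^ 2 - 5 * real n + 12"
    "real n ^ 3 + 3 * real n * real n + 2 * real n - 6 * real n ^ 2 - 6 * real n + 18 * real n - 24 =
     real n ^ 3 - 3 * real n ^ 2 + 14 * real n - 24"
    by (simp_all add: power2_eq_square)
  then show ?thesis
    using chern_ratios_eq[OF gt] by (simp only: power_sum_replicate)
qed

lemma chern_ratios_vertex:
  "chern_ratios [5] = (1 / 16, 43 / 8)" "chern_ratios [2, 3] = (1 / 10, 19 / 5)"
  "chern_ratios [1, 2, 2] = (1 / 8, 13 / 4)" "chern_ratios [1, 1, 1, 1, 1] = (1 / 6, 8 / 3)"
  "chern_ratios [2, 2, 2] = (1 / 3, 23 / 12)"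
  using general_type_vertex[of 0] general_type_vertex[of 1] general_type_vertex[of 2]
    general_type_vertex[of 3] general_type_vertex[of 4]
  unfolding vertex_simps by (simp_all add: chern_ratios_eq power_sum_def)

lemma fst_vertex_less: "fst (chern_ratios (vertex k)) < fst (chern_ratios (vertex (Suc k)))"
proof (cases "k < 5")
  case True
  have 5: "chern_ratios (vertex 5) = (4 / 9, 14 / 9)"
    using chern_ratios_replicate[of 6] vertex_replicate[of 5] by simp
  show ?thesis
    using True unfolding less_5_cases by (elim disjE) (simp_all add: vertex_simps chern_ratios_vertex[simplified] 5)
next
  case False
  \<comment> \<open>This is the sum of the entries of \<open>vertex k\<close> minus 4.\<close>
  define x where "x = real k - 3"
  have x: "1 < x"
    using False by (simp add: x_def)
  have "fst (chern_ratios (vertex k)) = 2 * x\<^sup>2 / (x\<^sup>2 + 3 * x + 8)"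
    using False chern_ratios_replicate[of "k + 1"]
    by (simp add: vertex_replicate x_def power2_eq_square algebra_simps)
  moreover have "fst (chern_ratios (vertex (Suc k))) = 2 * (x + 1)\<^sup>2 / ((x + 1)\<^sup>2 + 3 * (x + 1) + 8)"
    using False chern_ratios_replicate[of "k + 2"]
    by (simp add: vertex_replicate x_def power2_eq_square algebra_simps)
  moreover have "0 < x\<^sup>2 + 3 * x + 8" "0 < (x + 1)\<^sup>2 + 3 * (x + 1) + 8"
    using x by (simp_all add: add_pos_pos)
  moreover have "2 * x\<^sup>2 * ((x + 1)\<^sup>2 + 3 * (x + 1) + 8) < 2 * (x + 1)\<^sup>2 * (x\<^sup>2 + 3 * x + 8)"
  proof -
    have "2 * (x + 1)\<^sup>2 * (x\<^sup>2 + 3 * x + 8) - 2 * x\<^sup>2 * ((x + 1)\<^sup>2 + 3 * (x + 1) + 8) = 6 * x\<^sup>2 + 38 * x + 16"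
      by algebra
    then show ?thesis
      using x by (smt (verit) zero_le_power2)
  qed
  ultimately show ?thesis
    by (simp add: divide_less_eq less_divide_eq mult.commute)
qed

lemma chern_ratios_vertex_lim: "(\<lambda>k. chern_ratios (vertex k)) \<longlonglongrightarrow> (2, 1 / 3)"
proof -
  \<comment> \<open>With \<open>n = k + 1\<close> and \<open>w = 1 / n\<close>, both coordinates
    become rational functions continuous at \<open>w = 0\<close>.\<close>
  define w where "w k = inverse (real (Suc k))" for k
  have w: "w \<longlonglongrightarrow> 0"
    unfolding w_def by (rule LIMSEQ_inverse_real_of_nat)
  have "(\<lambda>k. (2 * (1 - 4 * w k)\<^sup>2 / (1 - 5 * w k + 12 * w k ^ 2),
      (1 - 3 * w k + 14 * w k ^ 2 - 24 * w k ^ 3) / (3 * (1 - 4 * w k) * (1 - 5 * w k + 12 * w k ^ 2))))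
    \<longlonglongrightarrow> (2 * (1 - 4 * 0)\<^sup>2 / (1 - 5 * 0 + 12 * 0 ^ 2),
      (1 - 3 * 0 + 14 * 0 ^ 2 - 24 * 0 ^ 3) / (3 * (1 - 4 * 0) * (1 - 5 * 0 + 12 * 0 ^ 2)))"
    by (intro tendsto_intros w) auto
  moreover have "eventually (\<lambda>k. (2 * (1 - 4 * w k)\<^sup>2 / (1 - 5 * w k + 12 * w k ^ 2),
      (1 - 3 * w k + 14 * w k ^ 2 - 24 * w k ^ 3) / (3 * (1 - 4 * w k) * (1 - 5 * w k + 12 * w k ^ 2))) =
      chern_ratios (vertex k)) sequentially"
    using eventually_ge_at_top[of 5]
  proof eventually_elim
    case (elim k)
    define n where "n = real (k + 1)"
    have n: "6 \<le> n"
      using elim by (simp add: n_def)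
    have n0: "n \<noteq> 0"
      using n by simp
    have wn: "w k = 1 / n"
      by (simp add: w_def n_def inverse_eq_divide)
    have *: "1 - 4 * w k = (n - 4) / n" "1 - 5 * w k + 12 * w k ^ 2 = (n ^ 2 - 5 * n + 12) / n ^ 2"
      "1 - 3 * w k + 14 * w k ^ 2 - 24 * w k ^ 3 = (n ^ 3 - 3 * n ^ 2 + 14 * n - 24) / n ^ 3"
      using n0 unfolding wn by (simp_all add: field_simps power2_eq_square power3_eq_cube)
    have "chern_ratios (vertex k) = (2 * (n - 4)\<^sup>2 / (n ^ 2 - 5 * n + 12),
        (n ^ 3 - 3 * n ^ 2 + 14 * n - 24) / (3 * (n - 4) * (n ^ 2 - 5 * n + 12)))"
      using elim chern_ratios_replicate[of "k + 1"] unfolding n_def by (simp only: vertex_replicate)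
    then show ?case
      unfolding * using n0 by (simp add: power_divide power2_eq_square power3_eq_cube)
  qed
  ultimately have "(\<lambda>k. chern_ratios (vertex k)) \<longlonglongrightarrow> (2 * (1 - 4 * 0)\<^sup>2 / (1 - 5 * 0 + 12 * 0 ^ 2),
      (1 - 3 * 0 + 14 * 0 ^ 2 - 24 * 0 ^ 3) / (3 * (1 - 4 * 0) * (1 - 5 * 0 + 12 * 0 ^ 2)))"
    by (rule Lim_transform_eventually)
  then show ?thesis
    by simp
qed

text \<open>The line here joins \<open>Q(1;5)\<close> to the limit \<open>(2, 1/3)\<close> of the corners.\<close>

lemma chern_ratios_cap:
  assumes "general_type ds"
  shows "chern_ratios ds = (1 / 16, 43 / 8) \<or>
    1 / 16 < fst (chern_ratios ds) \<and> fst (chern_ratios ds) < 2 \<and>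
    snd (chern_ratios ds) < 515 / 93 - 242 / 93 * fst (chern_ratios ds)"
proof -
  obtain p e u where p: "1 \<le> p" and e: "0 \<le> e"
    and sums: "power_sum 1 ds = real p + 4" "power_sum 2 ds = real p + 4 + e" "power_sum 3 ds = u"
    and t: "real p + 4 + e \<le> (real p + 4)\<^sup>2"
    and u: "u \<le> (real p + 4) * (real p + 4 + e)"
    and one: "p = 1 \<Longrightarrow> (real p + 4 + e, u) \<in>
      {(5, 5), (7, 11), (9, 17), (11, 29), (13, 35), (17, 65), (25, 125)}"
    using general_type_power_sums[OF assms] by metis
  define x where "x = real p"
  define c where "c = x\<^sup>2 + 3 * x + 8 + e"
  have x: "1 \<le> x"
    using p by (simp add: x_def)
  have c: "0 < c"
    using x e by (simp add: c_def add_pos_nonneg)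
  have ratio: "fst (chern_ratios ds) = 2 * x\<^sup>2 / c"
    unfolding chern_ratios_eq[OF assms] sums c_def x_def by (simp add: power2_eq_square algebra_simps)
  have right: "fst (chern_ratios ds) < 2"
    unfolding ratio using c x e by (simp add: divide_less_eq) (simp add: c_def)
  \<comment> \<open>The excluded pair \<open>(25, 125)\<close> is that of \<open>[5]\<close>, the
    left end of the cap line.\<close>
  show ?thesis
  proof (cases "p = 1 \<and> (real p + 4 + e, u) = (25, 125)")
    case True
    then have "real p = 1" "e = 20" "u = 125"
      by auto
    then show ?thesis
      unfolding chern_ratios_eq[OF assms] sums by simp
  next
    case False
    \<comment> \<open>The first part says that the first coordinate exceeds 1/16; the constants of
      the form encode \<open>y = 515/93 - 242/93 x\<close>.\<close>
    have "c < 32 * x\<^sup>2 \<and> line_form 93 515 (- 1452) (x + 4) (x + 4 + e) u < 0"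
    proof (cases "p = 1")
      case True
      then show ?thesis
        using one False by (auto simp: line_form_def c_def x_def)
    next
      case p1: False
      define i where "i = x - 2"
      \<comment> \<open>The form becomes \<open>186 * d\<close>, minus a positive polynomial in
        \<open>i\<close>, minus \<open>f\<close>, where \<open>d\<close> is at most 0 because
        \<open>s_3\<close> is at most \<open>s_1 * s_2\<close>.\<close>
      define d where "d = u - (x + 4) * (x + 4 + e)"
      define f where "f = e * (1080 * i + 858)"
      have i: "0 \<le> i" "x = i + 2"
        using p p1 by (simp_all add: i_def x_def)
      have "32 * x\<^sup>2 - (2 * x\<^sup>2 + 10 * x + 20) = 30 * i\<^sup>2 + 110 * i + 80"
        unfolding i(2) by algebra
      moreover have "c \<le> 2 * x\<^sup>2 + 10 * x + 20"
        using t by (simp add: c_def flip: x_def) (simp add: power2_eq_square algebra_simps)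
      ultimately have "c < 32 * x\<^sup>2"
        using i by (smt (verit) zero_le_power2)
      moreover have "line_form 93 515 (- 1452) (x + 4) (x + 4 + e) u =
          186 * d - (3612 * i\<^sup>2 + 21972 * i + 22800) - f"
        unfolding line_form_def d_def f_def i(2) by algebra
      moreover have "d \<le> 0" "0 \<le> f" "0 \<le> 3612 * i\<^sup>2"
        using e i(1) u by (simp_all add: d_def f_def x_def)
      ultimately show ?thesis
        using i(1) by (intro conjI) linarith+
    qed
    then have "1 / 16 < fst (chern_ratios ds)" and neg: "line_form 93 515 (- 1452) (power_sum 1 ds) (power_sum 2 ds) (power_sum 3 ds) < 0"
      using c unfolding ratio sums x_def by (simp_all add: less_divide_eq)
    moreover have "snd (chern_ratios ds) < 515 / 93 - 242 / 93 * fst (chern_ratios ds)"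
      using line_form_chern_ratios[OF assms, of 93 515 "- 1452"] neg by (auto simp: mult_less_0_iff)
    ultimately show ?thesis
      using right by blast
  qed
qed

section \<open>The convex hull, its corners and its faces\<close>

lemma hull_general_type_ratios:
  shows "convex hull general_type_ratios = convex hull (range (\<lambda>k. chern_ratios (vertex k)))"
    and "corners (convex hull general_type_ratios) = range (\<lambda>k. chern_ratios (vertex k))"
proof -
  define v where "v k = chern_ratios (vertex k)" for k
  have v0: "v 0 = (1 / 16, 43 / 8)"
    by (simp add: v_def vertex_simps chern_ratios_vertex)
  have inc: "fst (v k) < fst (v (Suc k))" for k
    unfolding v_def by (rule fst_vertex_less)
  have edge: "\<exists>a b. snd (v k) = a + b * fst (v k) \<and> snd (v (Suc k)) = a + b * fst (v (Suc k)) \<and>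
      snd (v (Suc (Suc k))) \<noteq> a + b * fst (v (Suc (Suc k))) \<and>
      (\<forall>q\<in>general_type_ratios. a + b * fst q \<le> snd q)" for k
  proof -
    obtain D \<alpha> \<beta> where D: "0 < D" and form: "list_form D \<alpha> \<beta> (vertex k) = 0"
      "list_form D \<alpha> \<beta> (vertex (Suc k)) = 0" "list_form D \<alpha> \<beta> (vertex (Suc (Suc k))) \<noteq> 0"
      "\<And>ds. general_type ds \<Longrightarrow> 0 \<le> list_form D \<alpha> \<beta> ds"
      using corner_line[of k] by metis
    have sgn: "\<exists>c>0. list_form D \<alpha> \<beta> ds = c * (snd (chern_ratios ds) - (\<alpha> / D + \<beta> / (6 * D) * fst (chern_ratios ds)))"
      if "general_type ds" for ds
      unfolding list_form_def by (rule line_form_chern_ratios[OF that D])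
    have zero: "list_form D \<alpha> \<beta> ds = 0 \<longleftrightarrow> snd (chern_ratios ds) = \<alpha> / D + \<beta> / (6 * D) * fst (chern_ratios ds)"
      and nonneg: "\<alpha> / D + \<beta> / (6 * D) * fst (chern_ratios ds) \<le> snd (chern_ratios ds)"
      if "general_type ds" for ds
      using sgn[OF that] form(4)[OF that] by (auto simp: zero_le_mult_iff)
    show ?thesis
      using form(1-3) nonneg general_type_vertex unfolding zero[OF general_type_vertex] v_def
      by (intro exI[of _ "\<alpha> / D"] exI[of _ "\<beta> / (6 * D)"]) (auto simp: general_type_ratios_eq)
  qed
  have lim: "v \<longlonglongrightarrow> (2, 1 / 3)"
    unfolding v_def by (rule chern_ratios_vertex_lim)
  have sub: "range v \<subseteq> general_type_ratios"
    by (auto simp: v_def general_type_ratios_eq general_type_vertex)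
  have cap: "q = v 0 \<or> fst (v 0) < fst q \<and> fst q < 2 \<and>
      (snd q - snd (v 0)) * (2 - fst (v 0)) < (1 / 3 - snd (v 0)) * (fst q - fst (v 0))"
    if q: "q \<in> general_type_ratios" for q
  proof -
    obtain ds where "general_type ds" "q = chern_ratios ds"
      using q unfolding general_type_ratios_eq by blast
    \<comment> \<open>The cap line rewritten through its points \<open>(1/16, 43/8)\<close> and
      \<open>(2, 1/3)\<close>.\<close>
    moreover have "(y - 43 / 8) * (2 - 1 / 16) < (1 / 3 - 43 / 8) * (x - 1 / 16)"
      if "y < 515 / 93 - 242 / 93 * x" for x y :: real
      using that by (simp add: field_simps)
    ultimately show ?thesis
      using chern_ratios_cap[of ds] unfolding v0 fst_conv snd_conv by blast
  qed
  show "convex hull general_type_ratios = convex hull (range (\<lambda>k. chern_ratios (vertex k)))"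
    and "corners (convex hull general_type_ratios) = range (\<lambda>k. chern_ratios (vertex k))"
    using convex_hull_chain[OF inc edge lim sub cap] by (simp_all add: corners_def v_def)
qed

lemma range_vertex:
  "range (\<lambda>k. chern_ratios (vertex k)) =
     {chern_ratios [5], chern_ratios [2, 3], chern_ratios [1, 2, 2], chern_ratios [2, 2, 2]}
     \<union> {chern_ratios (replicate n 1) | n. n \<ge> 5}" (is "?L = ?R")
proof
  have five: "replicate 5 1 = [1, 1, 1, 1, 1 :: nat]"
    by (simp add: eval_nat_numeral)
  show "?L \<subseteq> ?R"
  proof (rule image_subsetI)
    fix k
    show "chern_ratios (vertex k) \<in> ?R"
    proof (cases "k < 5")
      case True
      then show ?thesis
        using five unfolding less_5_cases by (auto simp: vertex_simps intro: exI[of _ 5])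
    next
      case False
      then have "chern_ratios (vertex k) = chern_ratios (replicate (k + 1) 1)" "5 \<le> k + 1"
        using vertex_replicate[of k] by simp_all
      then show ?thesis
        by blast
    qed
  qed
  have "\<exists>k. vertex k = replicate n 1" if n: "5 \<le> n" for n
  proof (cases "n = 5")
    case True
    then have "vertex 3 = replicate n 1"
      by (simp only: five vertex_simps)
    then show ?thesis ..
  next
    case False
    then have "vertex (n - 1) = replicate n 1"
      using n by (simp add: vertex_replicate)
    then show ?thesis ..
  qed
  then have "chern_ratios (replicate n 1) \<in> ?L" if "5 \<le> n" for n
    using that by (metis rangeI)
  moreover have "{chern_ratios [5], chern_ratios [2, 3], chern_ratios [1, 2, 2], chern_ratios [2, 2, 2]} =
      (\<lambda>k. chern_ratios (vertex k)) ` {0, 1, 2, 4}"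
    by (simp add: vertex_simps)
  ultimately show "?R \<subseteq> ?L"
    by blast
qed

lemma chern_ratios_rational: "chern_ratios ds \<in> \<rat> \<times> \<rat>"
proof -
  have "power_sum i ds \<in> \<rat>" for i
    by (induction ds) (auto simp: power_sum_def)
  then have "chern_coeff 1 ds \<in> \<rat>" "chern_coeff 2 ds \<in> \<rat>" "chern_coeff 3 ds \<in> \<rat>"
    unfolding chern_coeff_1 chern_coeff_2 chern_coeff_3 by (auto intro!: Rats_divide)
  moreover have "ci_degree ds \<in> \<rat>"
    by (induction ds) (auto simp: ci_degree_def)
  ultimately show ?thesis
    by (auto simp: chern_ratios_def chern_number_111_def chern_number_12_def chern_number_3_def)
qed

theorem theorem1p2:
  fixes P :: "(real \<times> real) set"
  assumes "P = convex hull general_type_ratios"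
  shows "gen_rational_polyhedron P \<and>
         infinite (corners P) \<and>
         infinite {F. F face_of P} \<and>
         corners P =
           {chern_ratios [5], chern_ratios [2, 3], chern_ratios [1, 2, 2], chern_ratios [2, 2, 2]}
           \<union> {chern_ratios (replicate n 1) | n. n \<ge> 5} \<and>
         chern_ratios [5] = (1 / 16, 43 / 8) \<and>
         chern_ratios [2, 3] = (1 / 10, 19 / 5) \<and>
         chern_ratios [1, 2, 2] = (1 / 8, 13 / 4) \<and>
         chern_ratios [2, 2, 2] = (1 / 3, 23 / 12) \<and>
         (\<forall>n::nat. n \<ge> 5 \<longrightarrow> chern_ratios (replicate n 1) =
           (2 * (real n - 4)\<^sup>2 / (real n ^ 2 - 5 * real n + 12),
            (real n ^ 3 - 3 * real n ^ 2 + 14 * real n - 24)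
              / (3 * (real n - 4) * (real n ^ 2 - 5 * real n + 12))))"
proof -
  define v where "v k = chern_ratios (vertex k)" for k
  have corners: "corners P = range v"
    unfolding assms v_def by (rule hull_general_type_ratios(2))
  have hull: "P = convex hull (corners P)"
    unfolding corners unfolding assms v_def by (rule hull_general_type_ratios(1))
  have "strict_mono (\<lambda>k. fst (v k))"
    by (simp add: strict_mono_Suc_iff v_def fst_vertex_less)
  then have "inj (\<lambda>k. fst (v k))"
    by (rule strict_mono_imp_inj_on)
  then have "inj v"
    by (auto simp: inj_def)
  then have inf: "infinite (corners P)"
    by (simp add: corners range_inj_infinite)
  \<comment> \<open>Each corner is a face by itself, so infinitely many corners give infinitely many
    faces.\<close>
  have "(\<lambda>x. {x}) ` corners P \<subseteq> {F. F face_of P}"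
    by (auto simp: corners_def face_of_singleton)
  moreover have "infinite ((\<lambda>x. {x}) ` corners P)"
    using inf by (simp add: finite_image_iff)
  ultimately have "infinite {F. F face_of P}"
    by (meson infinite_super)
  moreover have "corners P \<subseteq> \<rat> \<times> \<rat>"
    unfolding corners v_def using chern_ratios_rational by blast
  moreover have "corners P =
      {chern_ratios [5], chern_ratios [2, 3], chern_ratios [1, 2, 2], chern_ratios [2, 2, 2]}
      \<union> {chern_ratios (replicate n 1) | n. n \<ge> 5}"
    unfolding corners v_def by (rule range_vertex)
  ultimately show ?thesis
    unfolding gen_rational_polyhedron_def
    using hull inf chern_ratios_vertex chern_ratios_replicate by (intro conjI allI impI) assumption+
qed

end
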